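(* Let $n\ge 2$, let $c\in\mathbb{R}$, and let $\mathcal{T}_c$ be the Toda space of all real $n\times n$ upper triangular matrices $A$ with $A_{ii}=b_i\in\mathbb{R}$ for $1\le i\le n$, $A_{i,i+1}=a_i>0$ for $1\le i\le n-1$, all other entries zero, and $b_1+\cdots+b_n=c$. Let $G$ be the multiplicative group of real lower triangular $n\times n$ matrices with positive diagonal entries, acting on the space of real upper triangular $n\times n$ matrices by the coadjoint action $l\cdot u=[\,l\,u\,l^{-1}]_+$. Then $\mathcal{T}_c$ is a single orbit of this action of $G$.
   Context: For a square matrix $M$, $[M]_+$ denotes the projection of $M$ to its upper triangular part: all entries strictly below the diagonal are set to zero, and the diagonal and the entries above it are kept. The space of upper triangular matrices is identified with the dual of the Lie algebra of lower triangular matrices via the pairing $\langle A,B\rangle=\mathrm{Tr}(AB)$; under this identification the coadjoint action of $l\in G$ on an upper triangular matrix $u$ is $l\cdot u=[l u l^{-1}]_+$. *)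

theory Defs
  imports "Jordan_Normal_Form.Determinant" "HOL-Algebra.Group_Action"
begin

text \<open>Rows and columns are numbered from 0 to n - 1.\<close>

definition upper_part :: "'a::zero mat \<Rightarrow> 'a mat" where
  "upper_part M =
     mat (dim_row M) (dim_col M) (\<lambda>(i, j). if j < i then 0 else M $$ (i, j))"

definition lower_group :: "nat \<Rightarrow> real mat monoid" where
  "lower_group n =
     \<lparr>carrier = {L \<in> carrier_mat n n.
         (\<forall>i<n. \<forall>j<n. i < j \<longrightarrow> L $$ (i, j) = 0) \<and> (\<forall>i<n. L $$ (i, i) > 0)},
      mult = (*),
      one = 1\<^sub>m n\<rparr>"

definition upper_space :: "nat \<Rightarrow> real mat set" where
  "upper_space n = {U \<in> carrier_mat n n. upper_triangular U}"

text \<open>The restriction to the space acted on is the convention of \<^locale>\<open>group_action\<close>,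
  whose actions are homomorphisms into a group of extensional bijections.\<close>

definition coadjoint :: "nat \<Rightarrow> real mat \<Rightarrow> real mat \<Rightarrow> real mat" where
  "coadjoint n L = (\<lambda>U \<in> upper_space n. upper_part (L * U * inv\<^bsub>lower_group n\<^esub> L))"

definition toda_space :: "nat \<Rightarrow> real \<Rightarrow> real mat set" where
  "toda_space n c =
     {mat n n (\<lambda>(i, j). if j = i then b i else if j = Suc i then a i else 0) | a b.
        (\<forall>i. Suc i < n \<longrightarrow> a i > 0) \<and> (\<Sum>i<n. b i) = c}"

lemma mult_index_sum:
  assumes "A \<in> carrier_mat n n" "B \<in> carrier_mat n n" "i < n" "j < n"
  shows "(A * B) $$ (i, j) = (\<Sum>k<n. A $$ (i, k) * B $$ (k, j))"
  using assms by (simp add: scalar_prod_def atLeast0LessThan)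

lemma mem_lower_group:
  "L \<in> carrier (lower_group n) \<longleftrightarrow> L \<in> carrier_mat n n \<and>
     (\<forall>i<n. \<forall>j<n. i < j \<longrightarrow> L $$ (i, j) = 0) \<and> (\<forall>i<n. L $$ (i, i) > 0)"
  by (simp add: lower_group_def)

lemma lower_group_simps [simp]:
  "mult (lower_group n) = (*)" "one (lower_group n) = 1\<^sub>m n"
  by (simp_all add: lower_group_def)

lemma lower_mult_diag:
  fixes A B :: "real mat"
  assumes "A \<in> carrier_mat n n" "B \<in> carrier_mat n n" "i < n"
    and "\<And>j. j < n \<Longrightarrow> i < j \<Longrightarrow> A $$ (i, j) = 0"
    and "\<And>k. k < i \<Longrightarrow> B $$ (k, j) = 0" and "j < n"
  shows "(A * B) $$ (i, j) = A $$ (i, i) * B $$ (i, j)"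
proof -
  have "(\<Sum>k<n. A $$ (i, k) * B $$ (k, j)) = (\<Sum>k\<in>{i}. A $$ (i, k) * B $$ (k, j))"
  proof (rule sum.mono_neutral_right)
    show "\<forall>k\<in>{..<n} - {i}. A $$ (i, k) * B $$ (k, j) = 0"
    proof
      fix k assume "k \<in> {..<n} - {i}"
      then have "k < n" "k < i \<or> i < k" by auto
      then show "A $$ (i, k) * B $$ (k, j) = 0" using assms(4,5) by auto
    qed
  qed (use assms in auto)
  then show ?thesis by (simp add: mult_index_sum[OF assms(1-3,6)] del: index_mult_mat(1))
qed

lemma lower_group_mult_closed:
  assumes A: "A \<in> carrier (lower_group n)" and B: "B \<in> carrier (lower_group n)"
  shows "A * B \<in> carrier (lower_group n)"
proof -
  have *: "(A * B) $$ (i, j) = A $$ (i, i) * B $$ (i, j)" if "i < n" "j < n" "i \<le> j" for i j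
    by (rule lower_mult_diag[of _ n]) (use A B that in \<open>auto simp: mem_lower_group\<close>)
  show ?thesis using A B by (auto simp: mem_lower_group * simp del: index_mult_mat(1))
qed

lemma lower_group_has_inverse:
  assumes A: "A \<in> carrier (lower_group n)"
  obtains B where "B \<in> carrier (lower_group n)" "B * A = 1\<^sub>m n"
proof -
  have Ac: "A \<in> carrier_mat n n" and Al: "\<And>i j. i < j \<Longrightarrow> j < n \<Longrightarrow> A $$ (i, j) = 0"
    and Ad: "\<And>i. i < n \<Longrightarrow> A $$ (i, i) > 0" using A by (auto simp: mem_lower_group)
  have "det A = prod_list (diag_mat A)" by (rule det_lower_triangular[OF Al Ac])
  also have "\<dots> \<noteq> 0"
    using Ac by (auto simp: prod_list_zero_iff diag_mat_def dest!: Ad)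
  finally have "A \<in> Units (ring_mat TYPE(real) n ())"
    by (rule det_non_zero_imp_unit[OF Ac])
  then obtain B where Bc: "B \<in> carrier_mat n n" and BA: "B * A = 1\<^sub>m n" and AB: "A * B = 1\<^sub>m n"
    by (auto simp: Units_def ring_mat_def)
  have Bl: "i < j \<Longrightarrow> j < n \<Longrightarrow> B $$ (i, j) = 0" for i j
  proof (induction i rule: less_induct)
    case (less i)
    have "(A * B) $$ (i, j) = A $$ (i, i) * B $$ (i, j)"
      by (rule lower_mult_diag[OF Ac Bc]) (use less Al in auto)
    then show ?case using AB Ad[of i] less by auto
  qed
  have "B $$ (i, i) > 0" if "i < n" for i
  proof -
    have "(A * B) $$ (i, i) = A $$ (i, i) * B $$ (i, i)"
      by (rule lower_mult_diag[OF Ac Bc]) (use that Al Bl in auto)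
    then have "A $$ (i, i) * B $$ (i, i) = 1" using AB that by simp
    then have "0 < A $$ (i, i) * B $$ (i, i)" by simp
    then show ?thesis using Ad[OF that] by (rule zero_less_mult_pos)
  qed
  then show ?thesis using Bc Bl BA by (intro that[of B]) (auto simp: mem_lower_group)
qed

lemma group_lower_group: "group (lower_group n)"
proof (rule groupI; simp)
  show "1\<^sub>m n \<in> carrier (lower_group n)" by (simp add: mem_lower_group)
next
  fix x y z
  assume "x \<in> carrier (lower_group n)" "y \<in> carrier (lower_group n)" "z \<in> carrier (lower_group n)"
  then show "x * y * z = x * (y * z)" by (auto simp: mem_lower_group intro: assoc_mult_mat)
next
  fix x assume x: "x \<in> carrier (lower_group n)"
  then have "x \<in> carrier_mat n n" by (simp add: mem_lower_group)
  then show "1\<^sub>m n * x = x" by simp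
  show "\<exists>y\<in>carrier (lower_group n). y * x = 1\<^sub>m n"
    using lower_group_has_inverse[OF x] by blast
qed (rule lower_group_mult_closed)

lemma strictly_lower_mult:
  fixes A B :: "real mat"
  assumes "A \<in> carrier_mat n n" "B \<in> carrier_mat n n" "i < n" "j < n" "i \<le> j"
    and "\<And>k. k < n \<Longrightarrow> A $$ (i, k) = 0 \<or> B $$ (k, j) = 0"
  shows "(A * B) $$ (i, j) = 0"
  unfolding mult_index_sum[OF assms(1-4)]
  by (rule sum.neutral) (use assms(6) in auto)

lemma upper_part_conj:
  fixes X :: "real mat"
  assumes L: "L \<in> carrier (lower_group n)" and M: "M \<in> carrier (lower_group n)"
    and X: "X \<in> carrier_mat n n"
  shows "upper_part (L * upper_part X * M) = upper_part (L * X * M)"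
proof -
  have Lc: "L \<in> carrier_mat n n" and Mc: "M \<in> carrier_mat n n"
    using L M by (auto simp: mem_lower_group)
  have Uc: "upper_part X \<in> carrier_mat n n" using X by (simp add: upper_part_def)
  define N where "N = X - upper_part X"
  have Nc: "N \<in> carrier_mat n n" using Uc unfolding N_def by (rule minus_carrier_mat)
  have N0: "N $$ (i, j) = 0" if "i < n" "j < n" "i \<le> j" for i j
    using that X by (auto simp: N_def upper_part_def)
  have LN: "(L * N) $$ (i, j) = 0" if "i < n" "j < n" "i \<le> j" for i j
  proof (rule strictly_lower_mult[OF Lc Nc that])
    show "L $$ (i, k) = 0 \<or> N $$ (k, j) = 0" if "k < n" for k
      using N0[of k j] L \<open>i < n\<close> \<open>j < n\<close> \<open>i \<le> j\<close> that
      by (cases "i < k") (auto simp: mem_lower_group)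
  qed
  have LNc: "L * N \<in> carrier_mat n n" using Lc Nc by simp
  have LNM: "(L * N * M) $$ (i, j) = 0" if "i < n" "j < n" "i \<le> j" for i j
  proof (rule strictly_lower_mult[OF LNc Mc that])
    show "(L * N) $$ (i, k) = 0 \<or> M $$ (k, j) = 0" if "k < n" for k
      using LN[of i k] M \<open>i < n\<close> \<open>j < n\<close> \<open>i \<le> j\<close> that
      by (cases "k < j") (auto simp: mem_lower_group simp del: index_mult_mat(1))
  qed
  have "X = upper_part X + N" using X Uc by (intro eq_matI) (auto simp: N_def upper_part_def)
  then have "L * X * M = L * (upper_part X + N) * M" by simp
  also have "\<dots> = L * upper_part X * M + L * N * M"
    using Lc Mc Uc Nc by (simp add: mult_add_distrib_mat[of _ n n] add_mult_distrib_mat[of _ n n])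
  finally have *: "L * X * M = L * upper_part X * M + L * N * M" .
  have "(L * X * M) $$ (i, j) = (L * upper_part X * M) $$ (i, j)" if "i < n" "j < n" "i \<le> j" for i j
    unfolding * using that LNM[OF that] Lc Mc Nc Uc by (subst index_add_mat) auto
  then show ?thesis using Lc Mc X Uc
    by (intro eq_matI) (auto simp: upper_part_def simp del: index_mult_mat(1))
qed

lemma upper_part_upper: "U \<in> upper_space n \<Longrightarrow> upper_part U = U"
  by (intro eq_matI) (auto simp: upper_part_def upper_space_def upper_triangular_def)

lemma group_action_coadjoint: "group_action (lower_group n) (upper_space n) (coadjoint n)"
proof -
  interpret G: group "lower_group n" by (rule group_lower_group)
  let ?G = "lower_group n" and ?E = "upper_space n"
  let ?i = "\<lambda>l. inv\<^bsub>lower_group n\<^esub> l"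
  have cm: "l \<in> carrier_mat n n" if "l \<in> carrier ?G" for l using that by (simp add: mem_lower_group)
  have ic: "?i l \<in> carrier_mat n n" if "l \<in> carrier ?G" for l using that cm by simp
  have E: "u \<in> carrier_mat n n" if "u \<in> ?E" for u using that by (simp add: upper_space_def)
  have maps: "coadjoint n l u \<in> ?E" if "l \<in> carrier ?G" "u \<in> ?E" for l u
    using cm[OF that(1)] ic[OF that(1)] that(2)
    by (auto simp: coadjoint_def upper_space_def upper_part_def upper_triangular_def)
  have one: "coadjoint n (1\<^sub>m n) u = u" if "u \<in> ?E" for u
    using that E[OF that] G.inv_one by (simp add: coadjoint_def upper_part_upper)
  have act: "coadjoint n (l * m) u = coadjoint n l (coadjoint n m u)"
    if l: "l \<in> carrier ?G" and m: "m \<in> carrier ?G" and u: "u \<in> ?E" for l m u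
  proof -
    have "?i (l * m) = ?i m * ?i l" using G.inv_mult_group[OF l m] by simp
    then have "l * m * u * ?i (l * m) = l * (m * u * ?i m) * ?i l"
      using cm[OF l] cm[OF m] ic[OF l] ic[OF m] E[OF u] by (simp add: assoc_mult_mat[of _ n n _ n _ n])
    then show ?thesis
      using u maps[OF m u] upper_part_conj[OF l, of "?i l" "m * u * ?i m"] l cm[OF m] ic[OF m] E[OF u]
      by (simp add: coadjoint_def)
  qed
  have inv1: "coadjoint n (?i l) (coadjoint n l u) = u" if "l \<in> carrier ?G" "u \<in> ?E" for l u
    using act[of "?i l" l u] G.l_inv[OF that(1)] one that by simp
  have inv2: "coadjoint n l (coadjoint n (?i l) u) = u" if "l \<in> carrier ?G" "u \<in> ?E" for l u
    using act[of l "?i l" u] G.r_inv[OF that(1)] one that by simp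
  have Bij: "coadjoint n l \<in> Bij ?E" if "l \<in> carrier ?G" for l
  proof -
    have "bij_betw (coadjoint n l) ?E ?E"
      by (rule bij_betw_byWitness[where f' = "coadjoint n (?i l)"])
        (use that inv1 inv2 maps in auto)
    then show ?thesis by (simp add: Bij_def coadjoint_def)
  qed
  have "coadjoint n (l * m) = compose ?E (coadjoint n l) (coadjoint n m)"
    if "l \<in> carrier ?G" "m \<in> carrier ?G" for l m
  proof (rule extensionalityI)
    show "coadjoint n (l * m) \<in> extensional ?E" by (simp add: coadjoint_def)
  qed (use that act in \<open>auto simp: compose_def\<close>)
  then have "coadjoint n \<in> hom ?G (BijGroup ?E)"
    using Bij by (auto simp: hom_def BijGroup_def)
  then show ?thesis
    by (simp add: group_action_def group_hom_def group_hom_axioms_def group_lower_group group_BijGroup)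
qed

end

theory Submission
  imports Defs
begin

text \<open>
  Write \<open>[M]\<^sub>+\<close> for \<^term>\<open>upper_part M\<close>. A single orbit means two things: the action keeps the Toda
  space in itself, and it moves any Toda matrix to any other one.

  For the first, conjugating a Toda matrix by a lower triangular \<open>L\<close> spreads its entries only
  downwards and to the left. So no entry appears above the superdiagonal, and each superdiagonal
  entry is only rescaled, by \<open>L\<^bsub>i,i\<^esub> / L\<^bsub>i+1,i+1\<^esub> > 0\<close> (\<open>conj_above_superdiagonal\<close>,
  \<open>conj_superdiagonal\<close>). The projection does not touch the diagonal, hence not the trace,
  and conjugation preserves the trace.

  For the second, let \<open>U\<close> have diagonal \<open>b\<close> and superdiagonal \<open>a\<close>, and let \<open>T\<close> have \<open>b'\<close> and \<open>a'\<close>.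
  Multiplying on the right by \<open>L\<close> removes the inverse: \<open>[L U L\<^sup>-\<^sup>1]\<^sub>+ = T\<close> follows from
  \<open>[L U]\<^sub>+ = [T L]\<^sub>+\<close> (\<open>coadjoint_eqI\<close>), which is linear in \<open>L\<close>. It already has a bidiagonal solution.
  If \<open>d\<close> is the diagonal of \<open>L\<close> and \<open>e\<close> its subdiagonal, the superdiagonal entries of the equation say
  \<open>d\<^sub>i a\<^sub>i = a'\<^sub>i d\<^bsub>i+1\<^esub>\<close>, and the diagonal ones
  \<open>d\<^sub>i b\<^sub>i + e\<^bsub>i-1\<^esub> a\<^bsub>i-1\<^esub> = b'\<^sub>i d\<^sub>i + a'\<^sub>i e\<^sub>i\<close>. The first recursion gives \<open>d\<close> as a product of quotients
  \<open>a\<^sub>k / a'\<^sub>k\<close>. Substituting \<open>a'\<^sub>i e\<^sub>i = d\<^sub>i s\<^sub>i\<close> turns the second one into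
  \<open>s\<^sub>i = s\<^bsub>i-1\<^esub> + b\<^sub>i - b'\<^sub>i\<close>, so \<open>s\<close> is the sequence of partial sums of \<open>b - b'\<close>. The last row has
  no \<open>e\<close> left to choose: it requires the total of \<open>b - b'\<close> to vanish, that is, equal traces.
\<close>

text \<open>The entrywise form lets a matrix be recognised as a Toda matrix without naming its parameters.\<close>

lemma mem_toda_space:
  "A \<in> toda_space n c \<longleftrightarrow> A \<in> carrier_mat n n \<and>
     (\<forall>i<n. \<forall>j<n. j \<noteq> i \<longrightarrow> j \<noteq> Suc i \<longrightarrow> A $$ (i, j) = 0) \<and>
     (\<forall>i. Suc i < n \<longrightarrow> A $$ (i, Suc i) > 0) \<and> (\<Sum>i<n. A $$ (i, i)) = c"
  (is "_ \<longleftrightarrow> ?entries")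
proof
  assume "A \<in> toda_space n c"
  then show ?entries by (auto simp: toda_space_def)
next
  assume A: ?entries
  then have "A = mat n n (\<lambda>(i, j). if j = i then A $$ (i, i)
                                   else if j = Suc i then A $$ (i, Suc i) else 0)"
    by (intro eq_matI) auto
  with A show "A \<in> toda_space n c"
    unfolding toda_space_def
    by (intro CollectI exI[of _ "\<lambda>i. A $$ (i, Suc i)"] exI[of _ "\<lambda>i. A $$ (i, i)"]) simp
qed

lemma toda_space_subset_upper_space: "toda_space n c \<subseteq> upper_space n"
  by (auto simp: mem_toda_space upper_space_def upper_triangular_def)

lemma toda_space_nonempty:
  assumes "0 < n"
  shows "toda_space n c \<noteq> {}"
proof -
  have "(\<Sum>i<n. if i = 0 then c else 0) = c" using assms by (simp add: sum.delta)
  then have "mat n n (\<lambda>(i, j). if j = i then if i = 0 then c else 0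
                               else if j = Suc i then 1 else 0) \<in> toda_space n c"
    unfolding toda_space_def
    by (intro CollectI exI[of _ "\<lambda>i. 1"] exI[of _ "\<lambda>i. if i = 0 then c else 0"]) simp
  then show ?thesis by blast
qed

section \<open>Invariance of the Toda space\<close>

lemma sum_diag_mult_commute:
  fixes A B :: "'a::comm_semiring_0 mat"
  assumes "A \<in> carrier_mat n n" "B \<in> carrier_mat n n"
  shows "(\<Sum>i<n. (A * B) $$ (i, i)) = (\<Sum>i<n. (B * A) $$ (i, i))"
proof -
  have "(\<Sum>i<n. (A * B) $$ (i, i)) = (\<Sum>i<n. \<Sum>k<n. A $$ (i, k) * B $$ (k, i))"
    using assms by (intro sum.cong) (simp_all add: scalar_prod_def atLeast0LessThan)
  also have "\<dots> = (\<Sum>k<n. \<Sum>i<n. B $$ (k, i) * A $$ (i, k))"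
    by (subst sum.swap) (simp add: mult.commute)
  also have "\<dots> = (\<Sum>i<n. (B * A) $$ (i, i))"
    using assms by (intro sum.cong) (simp_all add: scalar_prod_def atLeast0LessThan)
  finally show ?thesis .
qed

text \<open>
  Left multiplication by a lower triangular matrix rescales row \<open>i\<close> and adds to it
  multiples of the rows above. Those rows end
  further to the left, so from the superdiagonal on only the multiple of row \<open>i\<close> itself is seen.
\<close>

lemma lower_mult_toda_above_diagonal:
  fixes L U :: "real mat"
  assumes "L \<in> carrier (lower_group n)" "U \<in> toda_space n c" "i < j" "j < n"
  shows "(L * U) $$ (i, j) = L $$ (i, i) * U $$ (i, j)"
  by (rule lower_mult_diag[of _ n]) (use assms in \<open>auto simp: mem_lower_group mem_toda_space\<close>)

lemma conj_above_superdiagonal: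
  assumes "L \<in> carrier (lower_group n)" "M \<in> carrier (lower_group n)" "U \<in> toda_space n c"
    and "Suc i < j" "j < n"
  shows "(L * U * M) $$ (i, j) = 0"
proof (rule strictly_lower_mult[of _ n])
  show "(L * U) $$ (i, k) = 0 \<or> M $$ (k, j) = 0" if "k < n" for k
    using that assms lower_mult_toda_above_diagonal[OF assms(1,3), of i k]
    by (cases "k < j") (auto simp: mem_lower_group mem_toda_space simp del: index_mult_mat(1))
qed (use assms in \<open>auto simp: mem_lower_group mem_toda_space\<close>)

lemma conj_superdiagonal:
  assumes L: "L \<in> carrier (lower_group n)" and M: "M \<in> carrier (lower_group n)"
    and U: "U \<in> toda_space n c" and i: "Suc i < n"
  shows "(L * U * M) $$ (i, Suc i) = L $$ (i, i) * U $$ (i, Suc i) * M $$ (Suc i, Suc i)"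
proof -
  have carr: "L * U \<in> carrier_mat n n" "M \<in> carrier_mat n n" "i < n"
    using L M U i by (auto simp: mem_lower_group mem_toda_space)
  have "(L * U * M) $$ (i, Suc i) = (\<Sum>k<n. (L * U) $$ (i, k) * M $$ (k, Suc i))"
    by (rule mult_index_sum[OF carr i])
  also have "\<dots> = (\<Sum>k\<in>{Suc i}. (L * U) $$ (i, k) * M $$ (k, Suc i))"
  proof (rule sum.mono_neutral_right)
    show "\<forall>k\<in>{..<n} - {Suc i}. (L * U) $$ (i, k) * M $$ (k, Suc i) = 0"
    proof
      fix k assume k: "k \<in> {..<n} - {Suc i}"
      then consider "k < Suc i" "k < n" | "Suc i < k" "k < n" by force
      then show "(L * U) $$ (i, k) * M $$ (k, Suc i) = 0"
      proof cases
        case 1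
        then show ?thesis using M i by (simp add: mem_lower_group)
      next
        case 2
        then show ?thesis
          using lower_mult_toda_above_diagonal[OF L U, of i k] U i by (simp add: mem_toda_space)
      qed
    qed
  qed (use i in auto)
  also have "\<dots> = L $$ (i, i) * U $$ (i, Suc i) * M $$ (Suc i, Suc i)"
    using lower_mult_toda_above_diagonal[OF L U, of i "Suc i"] i
    by (simp del: index_mult_mat(1))
  finally show ?thesis .
qed

lemma coadjoint_toda_space:
  assumes L: "L \<in> carrier (lower_group n)" and U: "U \<in> toda_space n c"
  shows "coadjoint n L U \<in> toda_space n c"
proof -
  interpret G: group "lower_group n" by (rule group_lower_group)
  define M where "M = inv\<^bsub>lower_group n\<^esub> L"
  have M: "M \<in> carrier (lower_group n)" unfolding M_def using L by simp
  have inv_L: "M * L = 1\<^sub>m n" unfolding M_def using G.l_inv[OF L] by simp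
  have carr: "L \<in> carrier_mat n n" "M \<in> carrier_mat n n" "U \<in> carrier_mat n n"
    using L M U by (auto simp: mem_lower_group mem_toda_space)
  have eq: "coadjoint n L U = upper_part (L * U * M)"
    using U toda_space_subset_upper_space by (auto simp: coadjoint_def M_def)
  have entry: "coadjoint n L U $$ (i, j) = (if j < i then 0 else (L * U * M) $$ (i, j))"
    if "i < n" "j < n" for i j
    unfolding eq using that carr by (simp add: upper_part_def del: index_mult_mat(1))
  have "coadjoint n L U \<in> carrier_mat n n" unfolding eq using carr by (simp add: upper_part_def)
  moreover have "coadjoint n L U $$ (i, j) = 0" if "i < n" "j < n" "j \<noteq> i" "j \<noteq> Suc i" for i j
    using that conj_above_superdiagonal[OF L M U, of i j] by (simp add: entry del: index_mult_mat(1))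
  moreover have "coadjoint n L U $$ (i, Suc i) > 0" if "Suc i < n" for i
    using that conj_superdiagonal[OF L M U that] L M U
    by (simp add: entry mem_lower_group mem_toda_space del: index_mult_mat(1))
  moreover have "(\<Sum>i<n. coadjoint n L U $$ (i, i)) = c"
  proof -
    have "(\<Sum>i<n. coadjoint n L U $$ (i, i)) = (\<Sum>i<n. (L * U * M) $$ (i, i))"
      by (simp add: entry del: index_mult_mat(1))
    also have "\<dots> = (\<Sum>i<n. (M * (L * U)) $$ (i, i))"
      using carr by (intro sum_diag_mult_commute) auto
    also have "M * (L * U) = M * L * U" using carr by (simp add: assoc_mult_mat[of _ n n _ n _ n])
    also have "\<dots> = U" using carr by (simp add: inv_L)
    also have "(\<Sum>i<n. U $$ (i, i)) = c" using U by (simp add: mem_toda_space)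
    finally show ?thesis .
  qed
  ultimately show ?thesis by (simp add: mem_toda_space)
qed

section \<open>Transitivity on the Toda space\<close>

text \<open>
  A strictly lower triangular matrix stays so after multiplication by \<open>L\<^sup>-\<^sup>1\<close>, so the difference
  between \<open>L U\<close> and \<open>T L\<close> may be ignored below the diagonal before the inverse is applied.
\<close>

lemma coadjoint_eqI:
  assumes L: "L \<in> carrier (lower_group n)" and U: "U \<in> upper_space n" and T: "T \<in> upper_space n"
    and eq: "upper_part (L * U) = upper_part (T * L)"
  shows "coadjoint n L U = T"
proof -
  interpret G: group "lower_group n" by (rule group_lower_group)
  define M where "M = inv\<^bsub>lower_group n\<^esub> L"
  have M: "M \<in> carrier (lower_group n)" unfolding M_def using L by simp
  have L_inv: "L * M = 1\<^sub>m n" unfolding M_def using G.r_inv[OF L] by simp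
  have carr: "L \<in> carrier_mat n n" "M \<in> carrier_mat n n" "U \<in> carrier_mat n n" "T \<in> carrier_mat n n"
    using L M U T by (auto simp: mem_lower_group upper_space_def)
  have mult_M: "upper_part (upper_part X * M) = upper_part (X * M)"
    if X: "X \<in> carrier_mat n n" for X
  proof -
    have "upper_part X \<in> carrier_mat n n" using X by (simp add: upper_part_def)
    then show ?thesis using upper_part_conj[OF _ M X, of "1\<^sub>m n"] G.one_closed X by simp
  qed
  have "coadjoint n L U = upper_part (L * U * M)" using U by (simp add: coadjoint_def M_def)
  also have "\<dots> = upper_part (T * L * M)" using mult_M[of "L * U"] mult_M[of "T * L"] carr eq by simp
  also have "T * L * M = T" using carr L_inv by (simp add: assoc_mult_mat[of _ n n _ n _ n])
  also have "upper_part T = T" using T by (rule upper_part_upper)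
  finally show ?thesis .
qed

lemma lower_bidiagonal_mult_entry:
  fixes L U :: "real mat"
  assumes L: "L \<in> carrier_mat n n" and U: "U \<in> carrier_mat n n" and ij: "i < n" "j < n"
    and zero: "\<And>k. k < n \<Longrightarrow> k \<noteq> i \<Longrightarrow> i \<noteq> Suc k \<Longrightarrow> L $$ (i, k) = 0"
  shows "(L * U) $$ (i, j) = L $$ (i, i) * U $$ (i, j) +
           (if i = 0 then 0 else L $$ (i, i - 1) * U $$ (i - 1, j))"
proof -
  have "(L * U) $$ (i, j) = (\<Sum>k\<in>{i, i - 1}. L $$ (i, k) * U $$ (k, j))"
    unfolding mult_index_sum[OF L U ij]
    by (rule sum.mono_neutral_right) (use ij zero in auto)
  then show ?thesis by (cases i) simp_all
qed

lemma upper_bidiagonal_mult_entry: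
  fixes T L :: "real mat"
  assumes T: "T \<in> carrier_mat n n" and L: "L \<in> carrier_mat n n" and ij: "i < n" "j < n"
    and zero: "\<And>k. k < n \<Longrightarrow> k \<noteq> i \<Longrightarrow> k \<noteq> Suc i \<Longrightarrow> T $$ (i, k) = 0"
  shows "(T * L) $$ (i, j) = T $$ (i, i) * L $$ (i, j) +
           (if Suc i < n then T $$ (i, Suc i) * L $$ (Suc i, j) else 0)"
proof -
  have "(T * L) $$ (i, j) = (\<Sum>k\<in>{i, Suc i} \<inter> {..<n}. T $$ (i, k) * L $$ (k, j))"
    unfolding mult_index_sum[OF T L ij]
    by (rule sum.mono_neutral_right) (use ij zero in auto)
  then show ?thesis using ij by (cases "Suc i < n") (simp_all add: Int_insert_left)
qed

lemma toda_space_transitive: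
  assumes U: "U \<in> toda_space n c" and T: "T \<in> toda_space n c"
  obtains L where "L \<in> carrier (lower_group n)" "coadjoint n L U = T"
proof -
  have Uc: "U \<in> carrier_mat n n" and Tc: "T \<in> carrier_mat n n"
    using U T by (auto simp: mem_toda_space)
  have U0: "U $$ (i, j) = 0" and T0: "T $$ (i, j) = 0"
    if "i < n" "j < n" "j \<noteq> i" "j \<noteq> Suc i" for i j
    using U T that by (auto simp: mem_toda_space)
  have Upos: "U $$ (i, Suc i) > 0" and Tpos: "T $$ (i, Suc i) > 0" if "Suc i < n" for i
    using U T that by (auto simp: mem_toda_space)
  define d where "d i = (\<Prod>k<i. U $$ (k, Suc k) / T $$ (k, Suc k))" for i
  define s where "s i = (\<Sum>k\<le>i. U $$ (k, k) - T $$ (k, k))" for i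
  define e where "e i = d i * s i / T $$ (i, Suc i)" for i
  define L where "L = mat n n (\<lambda>(i, j). if i = j then d i else if i = Suc j then e j else 0)"
  have Lc: "L \<in> carrier_mat n n" by (simp add: L_def)
  have L_entry: "L $$ (i, j) = (if i = j then d i else if i = Suc j then e j else 0)"
    if "i < n" "j < n" for i j using that by (simp add: L_def)
  have d_pos: "d i > 0" if "i < n" for i
    unfolding d_def using that Upos Tpos by (intro prod_pos) auto
  have LG: "L \<in> carrier (lower_group n)" using Lc d_pos by (auto simp: mem_lower_group L_entry)
  have d_Suc: "T $$ (i, Suc i) * d (Suc i) = d i * U $$ (i, Suc i)" if "Suc i < n" for i
    using Tpos[OF that] by (simp add: d_def)
  have e_right: "T $$ (i, Suc i) * e i = d i * s i" if "Suc i < n" for i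
    using Tpos[OF that] by (simp add: e_def)
  have e_left: "e i * U $$ (i, Suc i) = d (Suc i) * s i" if "Suc i < n" for i
    using Tpos[OF that] d_Suc[OF that] by (simp add: e_def field_simps)
  have s_Suc: "s (Suc i) = s i + U $$ (Suc i, Suc i) - T $$ (Suc i, Suc i)" for i
    by (simp add: s_def)
  have s_0: "s 0 = U $$ (0, 0) - T $$ (0, 0)" by (simp add: s_def)
  have s_last: "s i = 0" if "n = Suc i" for i
  proof -
    have "s i = (\<Sum>k<n. U $$ (k, k)) - (\<Sum>k<n. T $$ (k, k))"
      by (simp add: s_def that lessThan_Suc_atMost sum_subtractf)
    then show ?thesis using U T by (simp add: mem_toda_space)
  qed
  have LU: "(L * U) $$ (i, j) = L $$ (i, i) * U $$ (i, j) +
      (if i = 0 then 0 else L $$ (i, i - 1) * U $$ (i - 1, j))" if "i < n" "j < n" for i j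
    by (rule lower_bidiagonal_mult_entry[OF Lc Uc that]) (use that in \<open>simp add: L_entry\<close>)
  have TL: "(T * L) $$ (i, j) = T $$ (i, i) * L $$ (i, j) +
      (if Suc i < n then T $$ (i, Suc i) * L $$ (Suc i, j) else 0)" if "i < n" "j < n" for i j
    by (rule upper_bidiagonal_mult_entry[OF Tc Lc that]) (use that T0 in simp)
  have "(L * U) $$ (i, j) = (T * L) $$ (i, j)" if ij: "i \<le> j" "j < n" for i j
  proof -
    consider "j = i" | "j = Suc i" | "Suc i < j" using ij by linarith
    then show ?thesis
    proof cases
      case 1
      have "(L * U) $$ (i, i) = d i * (T $$ (i, i) + s i)"
      proof (cases i)
        case 0
        then show ?thesis using ij by (simp add: LU L_entry s_0 del: index_mult_mat(1))
      next
        case (Suc k)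
        then show ?thesis using ij e_left[of k]
          by (simp add: LU L_entry s_Suc algebra_simps del: index_mult_mat(1))
      qed
      also have "\<dots> = (T * L) $$ (i, i)"
      proof (cases "Suc i < n")
        case True
        then show ?thesis using e_right[OF True]
          by (simp add: TL L_entry algebra_simps del: index_mult_mat(1))
      next
        \<comment> \<open>In the last row the trace condition replaces the missing subdiagonal entry.\<close>
        case False
        then have "n = Suc i" using ij by simp
        then show ?thesis using s_last by (simp add: TL L_entry del: index_mult_mat(1))
      qed
      finally show ?thesis using 1 by simp
    next
      case 2
      then show ?thesis using ij d_Suc[of i] U0[of "i - 1" "Suc i"]
        by (simp add: LU TL L_entry del: index_mult_mat(1))
    next
      case 3
      then show ?thesis using ij U0[of "i - 1" j] U0[of i j]
        by (simp add: LU TL L_entry del: index_mult_mat(1))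
    qed
  qed
  then have "upper_part (L * U) = upper_part (T * L)"
    using Lc Uc Tc by (intro eq_matI) (auto simp: upper_part_def simp del: index_mult_mat(1))
  then have "coadjoint n L U = T"
    using LG U T toda_space_subset_upper_space by (intro coadjoint_eqI) auto
  with LG show ?thesis by (rule that)
qed

theorem proposition2p1:
  fixes n :: nat and c :: real
  assumes "n \<ge> 2"
  shows "toda_space n c \<in> orbits (lower_group n) (upper_space n) (coadjoint n)"
proof -
  from assms have "toda_space n c \<noteq> {}" by (intro toda_space_nonempty) simp
  then obtain U where U: "U \<in> toda_space n c" by blast
  have "toda_space n c = orbit (lower_group n) (coadjoint n) U"
    using coadjoint_toda_space[OF _ U] by (auto simp: orbit_def elim: toda_space_transitive[OF U])
  moreover have "U \<in> upper_space n" using U toda_space_subset_upper_space by blast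
  ultimately show ?thesis unfolding orbits_def by blast
qed

end
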